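(* Let $c,k$ be positive integers with $k$ odd, let $d,z$ be nonnegative integers, let $\zeta_{2c}$ be a primitive $2c$-th root of unity and $P\in\mathbb{Z}[\zeta_{2c}][x]$. If $n\ge(\deg(P)+2d+1)kc$, then $$\sum_{m=0}^n \zeta_{2c}^m P(m)\,q^{zm}\binom{n}{m}_q\equiv 0\pmod{\Phi_{kc}(q)^{d+1}}$$ in $\mathbb{Z}[\zeta_{2c}][q]$.
   Context: $\binom{n}{m}_q=\frac{(1-q^n)\cdots(1-q^{n-m+1})}{(1-q^m)\cdots(1-q)}$ is the $q$-binomial coefficient, and $\Phi_N(q)$ is the $N$-th cyclotomic polynomial. *)

theory Defs
  imports Complex_Main "HOL-Computational_Algebra.Computational_Algebra"
begin

definition primitive_unity_root :: "nat \<Rightarrow> complex \<Rightarrow> bool" where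
  "primitive_unity_root N \<omega> \<longleftrightarrow>
     N > 0 \<and> \<omega> ^ N = 1 \<and> (\<forall>j. 0 < j \<and> j < N \<longrightarrow> \<omega> ^ j \<noteq> 1)"

definition cyclotomic :: "nat \<Rightarrow> complex poly" where
  "cyclotomic N = (\<Prod>\<omega> | primitive_unity_root N \<omega>. [:- \<omega>, 1:])"

definition int_adjoin :: "complex \<Rightarrow> complex set" where
  "int_adjoin \<zeta> = range (\<lambda>p :: int poly. poly (map_poly of_int p) \<zeta>)"

definition polys_over :: "complex set \<Rightarrow> complex poly set" where
  "polys_over R = {p. \<forall>i. coeff p i \<in> R}"

text \<open>Congruence in the ring \<open>R[q]\<close>: the cofactor must itself have coefficients in \<open>R\<close>.\<close>
definition poly_cong_over :: "complex set \<Rightarrow> complex poly \<Rightarrow> complex poly \<Rightarrow> complex poly \<Rightarrow> bool" where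
  "poly_cong_over R a b f \<longleftrightarrow>
     a \<in> polys_over R \<and> b \<in> polys_over R \<and> f \<in> polys_over R \<and>
     (\<exists>h \<in> polys_over R. a - b = f * h)"

definition qbinom_num :: "nat \<Rightarrow> nat \<Rightarrow> complex poly" where
  "qbinom_num n m = (\<Prod>i<m. 1 - monom 1 (n - i))"

definition qbinom_den :: "nat \<Rightarrow> complex poly" where
  "qbinom_den m = (\<Prod>i<m. 1 - monom 1 (Suc i))"

text \<open>The polynomial division is exact, see \<open>qbinom_mult_den\<close> below. For \<open>m > n\<close> the numerator
  contains the factor \<open>1 - q\<^sup>0\<close> and vanishes.\<close>
definition qbinom :: "nat \<Rightarrow> nat \<Rightarrow> complex poly" where
  "qbinom n m = qbinom_num n m div qbinom_den m"

lemma qbinom_den_nonzero: "qbinom_den m \<noteq> 0"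
proof -
  have "(1 :: complex poly) - monom 1 (Suc i) \<noteq> 0" for i
  proof
    assume "(1 :: complex poly) - monom 1 (Suc i) = 0"
    then have "coeff ((1 :: complex poly) - monom 1 (Suc i)) 0 = 0" by simp
    then show False by simp
  qed
  then show ?thesis by (simp add: qbinom_den_def)
qed

lemma qbinom_num_Suc: "qbinom_num n (Suc m) = qbinom_num n m * (1 - monom 1 (n - m))"
  by (simp add: qbinom_num_def)

lemma qbinom_num_Suc_Suc: "qbinom_num (Suc n) (Suc m) = (1 - monom 1 (Suc n)) * qbinom_num n m"
  unfolding qbinom_num_def by (subst prod.lessThan_Suc_shift) simp

lemma qbinom_den_dvd_num: "qbinom_den m dvd qbinom_num n m"
proof (induction n arbitrary: m)
  case 0
  then show ?case
    by (cases m) (simp_all add: qbinom_num_def qbinom_den_def lessThan_Suc)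
next
  case (Suc n)
  show ?case
  proof (cases m)
    case 0
    then show ?thesis by (simp add: qbinom_num_def qbinom_den_def)
  next
    case (Suc m')
    show ?thesis
    proof (cases "m' \<le> n")
      case False
      then have "qbinom_num (Suc n) m = 0"
        unfolding qbinom_num_def using Suc
        by (intro prod_zero) (auto intro!: bexI[of _ "Suc n"])
      then show ?thesis by simp
    next
      case True
      let ?X = "\<lambda>i. monom (1 :: complex) i"
      have "?X (Suc n) = ?X (n - m') * ?X (Suc m')"
        using True by (simp add: mult_monom)
      then have eq: "qbinom_num (Suc n) m =
          qbinom_num n m + ?X (n - m') * (qbinom_num n m' * (1 - ?X (Suc m')))"
        unfolding Suc qbinom_num_Suc_Suc qbinom_num_Suc[of n m'] by (simp add: algebra_simps)
      have "qbinom_den m = qbinom_den m' * (1 - ?X (Suc m'))"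
        by (simp add: Suc qbinom_den_def)
      then have "qbinom_den m dvd qbinom_num n m' * (1 - ?X (Suc m'))"
        using Suc.IH[of m'] by (simp add: mult_dvd_mono)
      then show ?thesis
        unfolding eq using dvd_add[OF Suc.IH dvd_mult] by blast
    qed
  qed
qed

lemma qbinom_mult_den: "qbinom n m * qbinom_den m = qbinom_num n m"
  by (simp add: qbinom_def qbinom_den_dvd_num)

end

theory Submission
  imports Defs
begin

text \<open>
  Put \<open>N = kc\<close>, let \<open>\<omega>\<close> be a primitive \<open>N\<close>-th root of unity, and work in \<open>\<complex>[q][u]\<close> with
  \<open>X = \<zeta> q\<^sup>z (1 + u)\<close>. Extracting coefficients of \<open>u\<close> from the Rogers-Szego polynomials
  \<open>H n = (\<Sum>m. qbinom n m X\<^sup>m)\<close> turns \<open>\<zeta>\<^sup>m q\<^sup>z\<^sup>m\<close> into \<open>\<zeta>\<^sup>m q\<^sup>z\<^sup>m (m choose r)\<close>, and the binomial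
  coefficients with \<open>r \<le> deg P\<close> span the polynomial \<open>P\<close>. Filter the ring by giving
  \<open>q - \<omega>\<close> weight 2 and \<open>u\<close> weight 1. Then \<open>1 + X\<^sup>N\<close> has weight at least 1, and \<open>1 - q\<^sup>a\<^sup>N\<close> and
  the inner \<open>q\<close>-binomials \<open>qbinom N m\<close> have weight at least 2. The three-term recurrence of \<open>H\<close>
  shows that \<open>H (a N + b) - H b H (a N)\<close> has weight above \<open>a\<close>, whence \<open>H (a N + b)\<close> has weight
  at least \<open>a\<close>. For \<open>a = deg P + 2 d + 1\<close> the coefficients of \<open>u\<^sup>r\<close> with \<open>r \<le> deg P\<close> are divisible
  by \<open>(q - \<omega>)\<^sup>d\<^sup>+\<^sup>1\<close>. Integrality of the cofactor follows because the cyclotomic polynomial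
  is monic.
\<close>

section \<open>Gaussian binomial coefficients\<close>

lemma qbinom_den_Suc: "qbinom_den (Suc m) = qbinom_den m * (1 - monom 1 (Suc m))"
  by (simp add: qbinom_den_def)

lemma qbinom_0_right [simp]: "qbinom n 0 = 1"
  by (simp add: qbinom_def qbinom_num_def qbinom_den_def)

text \<open>The denominator is nonzero, so identities are proved by clearing it instead of reasoning
  about \<open>div\<close>.\<close>

lemma qbinom_eqI:
  assumes "p * qbinom_den m = qbinom_num n m"
  shows "qbinom n m = p"
  using assms qbinom_mult_den[of n m] qbinom_den_nonzero[of m] by (metis mult_right_cancel)

lemma qbinom_eq_0:
  assumes "n < m"
  shows "qbinom n m = 0"
proof (rule qbinom_eqI)
  show "0 * qbinom_den m = qbinom_num n m"
    using assms by (auto simp: qbinom_num_def intro!: bexI[of _ n])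
qed

lemma qbinom_same [simp]: "qbinom n n = 1"
proof (rule qbinom_eqI)
  have "(\<Prod>i<n. 1 - monom 1 (Suc i)) = (\<Prod>i<n. 1 - monom (1::complex) (n - i))"
    by (rule prod.reindex_bij_witness[of _ "\<lambda>i. n - Suc i" "\<lambda>i. n - Suc i"])
      (auto simp: Suc_diff_Suc)
  then show "1 * qbinom_den n = qbinom_num n n"
    by (simp add: qbinom_num_def qbinom_den_def)
qed

text \<open>The q-Pascal rule, from 1 - q^(n+1) = (1 - q^(n-m)) + q^(n-m) (1 - q^(m+1)) after
  clearing denominators.\<close>

lemma qbinom_Suc_Suc:
  assumes "m \<le> n"
  shows "qbinom (Suc n) (Suc m) = qbinom n (Suc m) + monom 1 (n - m) * qbinom n m"
proof (rule qbinom_eqI)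
  let ?X = "\<lambda>i. monom (1 :: complex) i"
  have X: "?X (Suc n) = ?X (n - m) * ?X (Suc m)"
    using assms by (simp add: mult_monom)
  have "(qbinom n (Suc m) + ?X (n - m) * qbinom n m) * qbinom_den (Suc m)
      = qbinom n (Suc m) * qbinom_den (Suc m)
        + ?X (n - m) * (1 - ?X (Suc m)) * (qbinom n m * qbinom_den m)"
    unfolding qbinom_den_Suc by (simp only: algebra_simps)
  also have "\<dots> = qbinom_num n m * (1 - ?X (n - m)) + ?X (n - m) * (1 - ?X (Suc m)) * qbinom_num n m"
    unfolding qbinom_mult_den qbinom_num_Suc by simp
  also have "\<dots> = (1 - ?X (n - m) * ?X (Suc m)) * qbinom_num n m"
    by (simp only: algebra_simps mult_1_left)
  finally show "(qbinom n (Suc m) + ?X (n - m) * qbinom n m) * qbinom_den (Suc m)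
      = qbinom_num (Suc n) (Suc m)"
    unfolding qbinom_num_Suc_Suc X .
qed

text \<open>Times \<open>qbinom_den m\<close>, both sides are
  \<open>qbinom_num (Suc n) (Suc m)\<close>, with its last or its first factor split off.\<close>

lemma qbinom_absorb:
  "qbinom (Suc n) m * (1 - monom 1 (Suc n - m)) = (1 - monom 1 (Suc n)) * qbinom n m"
proof -
  have "qbinom (Suc n) m * (1 - monom 1 (Suc n - m)) * qbinom_den m
      = (qbinom (Suc n) m * qbinom_den m) * (1 - monom 1 (Suc n - m))"
    by (simp only: ac_simps)
  also have "\<dots> = (1 - monom 1 (Suc n)) * (qbinom n m * qbinom_den m)"
    unfolding qbinom_mult_den by (metis qbinom_num_Suc qbinom_num_Suc_Suc)
  finally show ?thesis
    using qbinom_den_nonzero[of m] by (metis mult.assoc mult_right_cancel)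
qed

text \<open>Absorption removes the power q^(n+1-m) from the q-Pascal rule; the coefficients left
  depend on n only, so the relation can be summed over m.\<close>

lemma qbinom_three_term:
  "qbinom (Suc (Suc n)) (Suc m)
    = qbinom (Suc n) (Suc m) + qbinom (Suc n) m - (1 - monom 1 (Suc n)) * qbinom n m"
proof (cases "m \<le> Suc n")
  case True
  then show ?thesis
    using qbinom_Suc_Suc[OF True] qbinom_absorb[of n m] by (simp add: algebra_simps)
qed (simp add: qbinom_eq_0)

text \<open>The numerator factor 1 - q^N vanishes at \<omega>; by primitivity no denominator factor
  does, since m < N.\<close>

lemma poly_qbinom_primitive_root_eq_0:
  assumes "primitive_unity_root N \<omega>" "0 < m" "m < N"
  shows "poly (qbinom N m) \<omega> = 0"
proof -
  have "poly (qbinom N m) \<omega> * poly (qbinom_den m) \<omega> = poly (qbinom_num N m) \<omega>"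
    by (metis poly_mult qbinom_mult_den)
  also have "\<dots> = 0"
    using assms by (auto simp: qbinom_num_def poly_prod poly_monom primitive_unity_root_def
        intro!: bexI[of _ 0])
  finally have "poly (qbinom N m) \<omega> * poly (qbinom_den m) \<omega> = 0" .
  moreover have "\<omega> ^ Suc i \<noteq> 1" if "i < m" for i
  proof -
    have "0 < Suc i \<and> Suc i < N" using that assms by simp
    then show ?thesis using assms(1) unfolding primitive_unity_root_def by blast
  qed
  then have "poly (qbinom_den m) \<omega> \<noteq> 0"
    by (auto simp: qbinom_den_def poly_prod poly_monom simp del: power_Suc)
  ultimately show ?thesis by simp
qed

section \<open>Rogers-Szego polynomials\<close>

lemma smult_sum_right: "smult c (sum f A) = (\<Sum>x\<in>A. smult c (f x))"
  by (induction A rule: infinite_finite_induct) (auto simp: smult_add_right)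

definition rogers_szego :: "complex poly poly \<Rightarrow> nat \<Rightarrow> complex poly poly" where
  "rogers_szego X n = (\<Sum>m\<le>n. smult (qbinom n m) (X ^ m))"

lemma rogers_szego_0 [simp]: "rogers_szego X 0 = 1"
  by (simp add: rogers_szego_def)

lemma rogers_szego_1 [simp]: "rogers_szego X (Suc 0) = 1 + X"
  by (simp add: rogers_szego_def)

lemma rogers_szego_extend:
  assumes "n \<le> k"
  shows "rogers_szego X n = (\<Sum>m\<le>k. smult (qbinom n m) (X ^ m))"
  unfolding rogers_szego_def using assms
  by (intro sum.mono_neutral_left) (auto simp: qbinom_eq_0)

lemma rogers_szego_Suc_Suc:
  "rogers_szego X (Suc (Suc n)) = (1 + X) * rogers_szego X (Suc n)
    - smult (1 - monom 1 (Suc n)) (X * rogers_szego X n)"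
proof -
  have "rogers_szego X (Suc (Suc n))
      = 1 + (\<Sum>m\<le>Suc n. smult (qbinom (Suc (Suc n)) (Suc m)) (X ^ Suc m))"
    unfolding rogers_szego_def by (subst sum.atMost_Suc_shift) simp
  also have "\<dots> = 1 + (\<Sum>m\<le>Suc n. smult (qbinom (Suc n) (Suc m)) (X ^ Suc m)
      + X * smult (qbinom (Suc n) m) (X ^ m)
      - smult (1 - monom 1 (Suc n)) (X * smult (qbinom n m) (X ^ m)))"
    unfolding qbinom_three_term
    by (simp add: smult_add_left smult_diff_left del: sum.atMost_Suc)
  also have "\<dots> = (1 + (\<Sum>m\<le>Suc n. smult (qbinom (Suc n) (Suc m)) (X ^ Suc m)))
      + X * (\<Sum>m\<le>Suc n. smult (qbinom (Suc n) m) (X ^ m))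
      - smult (1 - monom 1 (Suc n)) (X * (\<Sum>m\<le>Suc n. smult (qbinom n m) (X ^ m)))"
    by (simp only: sum.distrib sum_subtractf sum_distrib_left smult_sum_right add.assoc add_diff_eq)
  \<comment> \<open>The 1 is the missing term of index 0, and the surplus top term has a vanishing
    q-binomial.\<close>
  also have "1 + (\<Sum>m\<le>Suc n. smult (qbinom (Suc n) (Suc m)) (X ^ Suc m)) = rogers_szego X (Suc n)"
    unfolding rogers_szego_extend[OF le_SucI[OF order_refl], of X "Suc n"]
      sum.atMost_Suc_shift[of _ "Suc n"]
    by simp
  also have "(\<Sum>m\<le>Suc n. smult (qbinom (Suc n) m) (X ^ m)) = rogers_szego X (Suc n)"
    by (rule rogers_szego_def[symmetric])
  also have "(\<Sum>m\<le>Suc n. smult (qbinom n m) (X ^ m)) = rogers_szego X n"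
    by (rule rogers_szego_extend[symmetric]) simp
  finally show ?thesis by (simp only: distrib_right mult_1_left)
qed

section \<open>The weight filtration\<close>

text \<open>The exponent is \<open>(a - r) / 2\<close> rounded up, and zero for \<open>r \<ge> a\<close>.\<close>
definition weight_ideal :: "'a::comm_ring_1 \<Rightarrow> nat \<Rightarrow> 'a poly set" where
  "weight_ideal \<pi> a = {f. \<forall>r. \<pi> ^ ((a - r + 1) div 2) dvd coeff f r}"

lemma weight_ideal_0 [simp]: "f \<in> weight_ideal \<pi> 0"
  by (simp add: weight_ideal_def)

lemma zero_in_weight_ideal [simp]: "0 \<in> weight_ideal \<pi> a"
  by (simp add: weight_ideal_def)

lemma weight_ideal_add:
  "f \<in> weight_ideal \<pi> a \<Longrightarrow> g \<in> weight_ideal \<pi> a \<Longrightarrow> f + g \<in> weight_ideal \<pi> a"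
  by (simp add: weight_ideal_def)

lemma weight_ideal_diff:
  "f \<in> weight_ideal \<pi> a \<Longrightarrow> g \<in> weight_ideal \<pi> a \<Longrightarrow> f - g \<in> weight_ideal \<pi> a"
  by (simp add: weight_ideal_def)

lemma weight_ideal_sum:
  "(\<And>x. x \<in> A \<Longrightarrow> f x \<in> weight_ideal \<pi> a) \<Longrightarrow> sum f A \<in> weight_ideal \<pi> a"
  by (induction A rule: infinite_finite_induct) (auto intro: weight_ideal_add)

lemma weight_ideal_antimono:
  assumes "f \<in> weight_ideal \<pi> a" "b \<le> a"
  shows "f \<in> weight_ideal \<pi> b"
  unfolding weight_ideal_def
proof safe
  fix r
  have "\<pi> ^ ((b - r + 1) div 2) dvd \<pi> ^ ((a - r + 1) div 2)"
    using assms(2) by (intro le_imp_power_dvd div_le_mono) auto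
  with assms(1) show "\<pi> ^ ((b - r + 1) div 2) dvd coeff f r"
    unfolding weight_ideal_def using dvd_trans by blast
qed

text \<open>Rounding up is subadditive, and truncated subtraction can only enlarge the two exponents
  on the right.\<close>

lemma weight_ideal_mult:
  assumes "f \<in> weight_ideal \<pi> a" "g \<in> weight_ideal \<pi> b"
  shows "f * g \<in> weight_ideal \<pi> (a + b)"
  unfolding weight_ideal_def
proof safe
  fix r
  show "\<pi> ^ ((a + b - r + 1) div 2) dvd coeff (f * g) r"
    unfolding coeff_mult
  proof (rule dvd_sum)
    fix i assume "i \<in> {..r}"
    then have "(a + b - r + 1) div 2 \<le> (a - i + 1) div 2 + (b - (r - i) + 1) div 2"
      by auto
    then have "\<pi> ^ ((a + b - r + 1) div 2)
        dvd \<pi> ^ ((a - i + 1) div 2) * \<pi> ^ ((b - (r - i) + 1) div 2)"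
      by (metis le_imp_power_dvd power_add)
    also have "\<dots> dvd coeff f i * coeff g (r - i)"
      using assms by (intro mult_dvd_mono) (auto simp: weight_ideal_def)
    finally show "\<pi> ^ ((a + b - r + 1) div 2) dvd coeff f i * coeff g (r - i)" .
  qed
qed

lemma weight_ideal_mult_left: "g \<in> weight_ideal \<pi> a \<Longrightarrow> f * g \<in> weight_ideal \<pi> a"
  using weight_ideal_mult[of f \<pi> 0 g a] by simp

lemma weight_ideal_smult: "g \<in> weight_ideal \<pi> a \<Longrightarrow> smult c g \<in> weight_ideal \<pi> a"
  using weight_ideal_mult_left[of g \<pi> a "[:c:]"] by simp

lemma weight_ideal_smult_dvd:
  assumes "g \<in> weight_ideal \<pi> a" "\<pi> dvd c"
  shows "smult c g \<in> weight_ideal \<pi> (a + 2)"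
proof -
  have "[:c:] \<in> weight_ideal \<pi> 2"
    using assms(2) by (auto simp: weight_ideal_def coeff_pCons split: nat.split)
  then show ?thesis
    using weight_ideal_mult[of "[:c:]" \<pi> 2 g a] assms(1) by (simp add: add.commute)
qed

lemma weight_ideal_1I:
  assumes "\<pi> dvd coeff f 0"
  shows "f \<in> weight_ideal \<pi> 1"
  unfolding weight_ideal_def
proof safe
  fix r show "\<pi> ^ ((1 - r + 1) div 2) dvd coeff f r"
    using assms by (cases r) auto
qed

section \<open>Weights of the Rogers-Szego polynomials\<close>

context
  fixes N :: nat and \<omega> :: complex and X :: "complex poly poly" and \<pi> :: "complex poly"
  assumes root: "primitive_unity_root N \<omega>"
    and X: "1 + X ^ N \<in> weight_ideal \<pi> 1"
    and \<pi>: "\<pi> = [:- \<omega>, 1:]"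
begin

lemma linear_dvd_one_minus_monom: "\<pi> dvd 1 - monom 1 (a * N)"
proof -
  have "\<omega> ^ (a * N) = 1"
    using root unfolding primitive_unity_root_def
    by (metis mult.commute power_mult power_one)
  then show ?thesis
    unfolding \<pi> by (simp add: poly_eq_0_iff_dvd[symmetric] poly_monom)
qed

text \<open>The two end terms form 1 + X^N; every inner q-binomial vanishes at \<omega>.\<close>

lemma rogers_szego_period_weight: "rogers_szego X N \<in> weight_ideal \<pi> 1"
proof -
  have N: "N > 0" using root by (simp add: primitive_unity_root_def)
  have "{..N} = insert 0 (insert N {0<..<N})" using N by auto
  then have "rogers_szego X N = (1 + X ^ N) + (\<Sum>m\<in>{0<..<N}. smult (qbinom N m) (X ^ m))"
    using N by (simp add: rogers_szego_def)
  moreover have "smult (qbinom N m) (X ^ m) \<in> weight_ideal \<pi> 1" if "m \<in> {0<..<N}" for m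
  proof -
    have "\<pi> dvd qbinom N m"
      unfolding \<pi> using poly_qbinom_primitive_root_eq_0[OF root] that
      by (simp add: poly_eq_0_iff_dvd[symmetric])
    from weight_ideal_smult_dvd[OF weight_ideal_0 this, of "X ^ m"] show ?thesis
      by (rule weight_ideal_antimono) simp
  qed
  ultimately show ?thesis
    using X by (auto intro!: weight_ideal_add weight_ideal_sum)
qed

text \<open>As functions of b, \<open>rogers_szego X (a * N + b)\<close> and
  \<open>rogers_szego X b * rogers_szego X (a * N)\<close> obey the same recurrence up to an error
  with factor 1 - q^(aN), which has weight 2.\<close>

lemma rogers_szego_shift_diff_weight:
  assumes H: "rogers_szego X (a * N) \<in> weight_ideal \<pi> a"
    and H': "a > 0 \<Longrightarrow> rogers_szego X (a * N - 1) \<in> weight_ideal \<pi> (a - 1)"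
  shows "rogers_szego X (a * N + b) - rogers_szego X b * rogers_szego X (a * N)
    \<in> weight_ideal \<pi> (a + 1)"
proof (induction b rule: induct_nat_012)
  case 0
  then show ?case by simp
next
  case 1
  show ?case
  proof (cases "a = 0")
    case False
    then have N: "a * N > 0" using root by (simp add: primitive_unity_root_def)
    then obtain M where M: "a * N = Suc M" using gr0_implies_Suc by blast
    \<comment> \<open>For b = 1 the difference is minus this term; as a > 0, the weight a - 1 + 2 is
      a + 1.\<close>
    have "smult (1 - monom 1 (a * N)) (X * rogers_szego X (a * N - 1)) \<in> weight_ideal \<pi> (a - 1 + 2)"
      using False by (intro weight_ideal_smult_dvd weight_ideal_mult_left H' linear_dvd_one_minus_monom) auto
    then have "0 - smult (1 - monom 1 (a * N)) (X * rogers_szego X (a * N - 1)) \<in> weight_ideal \<pi> (a + 1)"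
      using False by (intro weight_ideal_diff) auto
    then show ?thesis
      by (simp add: M rogers_szego_Suc_Suc)
  qed simp
next
  case (ge2 b)
  let ?H = "rogers_szego X" and ?q = "\<lambda>i. monom (1 :: complex) i"
  define D where "D b = ?H (a * N + b) - ?H b * ?H (a * N)" for b
  have D: "D b \<in> weight_ideal \<pi> (a + 1)" "D (Suc b) \<in> weight_ideal \<pi> (a + 1)"
    using ge2 by (simp_all add: D_def)
  have "?H (a * N + b) = D b + ?H b * ?H (a * N)"
    by (simp add: D_def)
  also have "\<dots> \<in> weight_ideal \<pi> a"
    using weight_ideal_antimono[OF D(1), of a] by (intro weight_ideal_add weight_ideal_mult_left H) auto
  finally have Hb: "?H (a * N + b) \<in> weight_ideal \<pi> a" .
  have q: "?q (a * N + Suc b) = ?q (a * N) * ?q (Suc b)"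
    by (simp add: mult_monom)
  \<comment> \<open>Subtract the two recurrences and split 1 - q^(aN+b+1) = (1 - q^(b+1)) + q^(b+1)
    (1 - q^(aN)).\<close>
  have "D (Suc (Suc b)) = (1 + X) * D (Suc b) - smult (1 - ?q (Suc b)) (X * D b)
      - smult (1 - ?q (a * N)) (smult (?q (Suc b)) (X * ?H (a * N + b)))"
    using q unfolding D_def
    by (simp add: rogers_szego_Suc_Suc algebra_simps smult_diff_left smult_diff_right smult_add_right)
  moreover have "smult (1 - ?q (a * N)) (smult (?q (Suc b)) (X * ?H (a * N + b)))
      \<in> weight_ideal \<pi> (a + 1)"
    by (rule weight_ideal_antimono[of _ _ "a + 2"])
      (intro weight_ideal_smult_dvd weight_ideal_smult weight_ideal_mult_left Hb
        linear_dvd_one_minus_monom, simp)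
  ultimately have "D (Suc (Suc b)) \<in> weight_ideal \<pi> (a + 1)"
    by (auto intro!: weight_ideal_diff weight_ideal_smult weight_ideal_mult_left D[simplified])
  then show ?case by (simp add: D_def)
qed

lemma rogers_szego_weight: "rogers_szego X (a * N + b) \<in> weight_ideal \<pi> a"
proof -
  let ?H = "rogers_szego X"
  have shift: "?H (a * N + b) \<in> weight_ideal \<pi> a"
    if "?H (a * N) \<in> weight_ideal \<pi> a"
      and "a > 0 \<Longrightarrow> ?H (a * N - 1) \<in> weight_ideal \<pi> (a - 1)" for a b
  proof -
    have "?H (a * N + b) = (?H (a * N + b) - ?H b * ?H (a * N)) + ?H b * ?H (a * N)"
      by simp
    also have "\<dots> \<in> weight_ideal \<pi> a"
      by (intro weight_ideal_add weight_ideal_mult_left that(1)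
          weight_ideal_antimono[OF rogers_szego_shift_diff_weight[OF that]]) simp_all
    finally show ?thesis .
  qed
  have N: "N > 0" using root by (simp add: primitive_unity_root_def)
  \<comment> \<open>The index a N - 1 is carried along for the base case b = 1 of the shift lemma.
    Shifting by N - 1 renews it, and shifting by N gains one weight from
    \<open>?H N\<close>.\<close>
  have "?H (a * N) \<in> weight_ideal \<pi> a \<and> (a > 0 \<longrightarrow> ?H (a * N - 1) \<in> weight_ideal \<pi> (a - 1))"
  proof (induction a)
    case (Suc a)
    have "?H (a * N + (N - 1)) \<in> weight_ideal \<pi> a"
      using Suc by (intro shift) auto
    moreover have "a * N + (N - 1) = Suc a * N - 1"
      using N by simp
    moreover have "?H (a * N + N) = (?H (a * N + N) - ?H N * ?H (a * N)) + ?H N * ?H (a * N)"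
      by simp
    then have "?H (a * N + N) \<in> weight_ideal \<pi> (a + 1)"
      using weight_ideal_add[OF rogers_szego_shift_diff_weight[of a N]]
        weight_ideal_mult[OF rogers_szego_period_weight, of "?H (a * N)" a] Suc
      by (metis add.commute)
    ultimately show ?case
      by (simp add: add.commute)
  qed simp
  then show ?thesis
    by (intro shift) auto
qed

end

section \<open>Divisibility over the complex numbers\<close>

text \<open>Horner's scheme in the binomial basis: multiplication by m sends (m choose r) to (r+1)
  (m choose r+1) + r (m choose r), so no division by factorials occurs.\<close>

lemma poly_of_nat_eq_sum_binomial:
  fixes P :: "'a::comm_ring_1 poly"
  shows "\<exists>c. \<forall>m. poly P (of_nat m) = (\<Sum>r\<le>degree P. c r * of_nat (m choose r))"
proof (induction P)
  case 0
  show ?case by (rule exI[of _ "\<lambda>_. 0"]) simp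
next
  case (pCons a P)
  show ?case
  proof (cases "P = 0")
    case True
    then show ?thesis by (intro exI[of _ "\<lambda>_. a"]) simp
  next
    case False
    from pCons.IH obtain c where
      c: "poly P (of_nat m) = (\<Sum>r\<le>degree P. c r * of_nat (m choose r))" for m by blast
    \<comment> \<open>The first summand holds a and the shifted terms, the second the unshifted
      ones; it is cut off because \<open>c\<close> is arbitrary beyond
      \<open>degree P\<close>.\<close>
    define e where "e r = (if r = 0 then a else of_nat r * c (r - 1))
      + (if r \<le> degree P then of_nat r * c r else 0)" for r
    have absorb: "m * (m choose r) = Suc r * (m choose Suc r) + r * (m choose r)" for m r
    proof (cases "r \<le> m")
      case True
      have "Suc r * (m choose Suc r) = (m - r) * (m choose r)"
        using binomial_absorb_comp[of m r] binomial_absorption[of r m] by simp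
      then show ?thesis
        using True by (metis add_mult_distrib le_add_diff_inverse2)
    qed (simp add: binomial_eq_0)
    have "poly (pCons a P) (of_nat m) = (\<Sum>r\<le>degree (pCons a P). e r * of_nat (m choose r))" for m
    proof -
      have "poly (pCons a P) (of_nat m) = a + (\<Sum>r\<le>degree P. c r * of_nat (m * (m choose r)))"
        by (simp add: c sum_distrib_left mult_ac)
      also have "\<dots> = a + (\<Sum>r\<le>degree P. of_nat (Suc r) * c r * of_nat (m choose Suc r))
          + (\<Sum>r\<le>degree P. of_nat r * c r * of_nat (m choose r))"
        unfolding absorb by (simp add: sum.distrib algebra_simps)
      also have "a + (\<Sum>r\<le>degree P. of_nat (Suc r) * c r * of_nat (m choose Suc r))
          = (\<Sum>r\<le>Suc (degree P). (if r = 0 then a else of_nat r * c (r - 1)) * of_nat (m choose r))"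
        by (subst sum.atMost_Suc_shift) simp
      also have "(\<Sum>r\<le>degree P. of_nat r * c r * of_nat (m choose r))
          = (\<Sum>r\<le>Suc (degree P). (if r \<le> degree P then of_nat r * c r else 0) * of_nat (m choose r))"
        by simp
      finally show ?thesis
        using False by (simp add: e_def distrib_right sum.distrib del: sum.atMost_Suc)
    qed
    then show ?thesis by blast
  qed
qed

lemma linear_power_dvd_qbinom_sum:
  assumes \<omega>: "primitive_unity_root N \<omega>" and \<zeta>: "\<zeta> ^ N = - 1"
    and n: "n \<ge> (degree P + 2 * d + 1) * N"
  shows "[:- \<omega>, 1:] ^ (d + 1) dvd
    (\<Sum>m\<le>n. smult (\<zeta> ^ m * poly P (of_nat m)) (monom 1 (z * m) * qbinom n m))"
proof -
  define \<pi> where "\<pi> = [:- \<omega>, 1:]"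
  \<comment> \<open>Here \<open>[:1, 1:]\<close> is 1 + u, so the coefficient of u^r in X^m is (m
    choose r) \<zeta>^m q^(zm).\<close>
  define X where "X = smult (monom \<zeta> z) [:1, 1 :: complex poly:]"
  have X_power: "X ^ m = smult (monom (\<zeta> ^ m) (z * m)) ([:1, 1:] ^ m)" for m
    by (simp only: X_def smult_power monom_power)
  have coeff_X: "coeff (X ^ m) r = smult (of_nat (m choose r)) (monom (\<zeta> ^ m) (z * m))" for m r
  proof (cases "r \<le> m")
    case True
    then show ?thesis
      by (simp add: X_power coeff_linear_poly_power of_nat_poly)
  next
    case False
    then show ?thesis
      by (simp add: X_power coeff_eq_0 degree_power_eq)
  qed
  \<comment> \<open>The value is 1 + \<zeta>^N \<omega>^(zN) = 1 - 1.\<close>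
  have "poly (coeff (1 + X ^ N) 0) \<omega> = 0"
  proof -
    have "\<omega> ^ (z * N) = 1"
      using \<omega> unfolding primitive_unity_root_def by (metis mult.commute power_mult power_one)
    then show ?thesis
      unfolding coeff_add coeff_X by (simp add: poly_monom \<zeta>)
  qed
  then have XN: "1 + X ^ N \<in> weight_ideal \<pi> 1"
    unfolding poly_eq_0_iff_dvd \<pi>_def by (rule weight_ideal_1I)
  \<comment> \<open>For r up to \<open>degree P\<close> this leaves a - r at least 2d + 1, and half
    of that rounds up to d + 1.\<close>
  define a where "a = degree P + 2 * d + 1"
  have "rogers_szego X (a * N + (n - a * N)) \<in> weight_ideal \<pi> a"
    by (rule rogers_szego_weight[OF \<omega> XN \<pi>_def])
  then have H: "rogers_szego X n \<in> weight_ideal \<pi> a"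
    using n by (simp add: a_def)
  obtain c where c: "poly P (of_nat m) = (\<Sum>r\<le>degree P. c r * of_nat (m choose r))" for m
    using poly_of_nat_eq_sum_binomial[of P] by blast
  have "(\<Sum>m\<le>n. smult (\<zeta> ^ m * poly P (of_nat m)) (monom 1 (z * m) * qbinom n m))
      = (\<Sum>m\<le>n. \<Sum>r\<le>degree P. smult (c r) (qbinom n m * coeff (X ^ m) r))"
  proof (rule sum.cong[OF refl])
    fix m
    have "monom (\<zeta> ^ m) (z * m) = smult (\<zeta> ^ m) (monom 1 (z * m))"
      by (simp add: smult_monom)
    then have "smult (\<zeta> ^ m * poly P (of_nat m)) (monom 1 (z * m) * qbinom n m)
        = smult (\<Sum>r\<le>degree P. c r * of_nat (m choose r)) (monom (\<zeta> ^ m) (z * m) * qbinom n m)"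
      unfolding c[symmetric] by (simp add: mult.commute)
    also have "\<dots> = (\<Sum>r\<le>degree P. smult (c r) (qbinom n m * coeff (X ^ m) r))"
      by (simp add: coeff_X smult_sum mult_ac)
    finally show "smult (\<zeta> ^ m * poly P (of_nat m)) (monom 1 (z * m) * qbinom n m) = \<dots>" .
  qed
  also have "\<dots> = (\<Sum>r\<le>degree P. smult (c r) (coeff (rogers_szego X n) r))"
    by (subst sum.swap) (simp add: rogers_szego_def coeff_sum smult_sum_right)
  also have "\<pi> ^ (d + 1) dvd \<dots>"
  proof (intro dvd_sum dvd_smult)
    fix r assume "r \<in> {..degree P}"
    then have "d + 1 \<le> (a - r + 1) div 2"
      by (auto simp: a_def)
    then have "\<pi> ^ (d + 1) dvd \<pi> ^ ((a - r + 1) div 2)"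
      by (rule le_imp_power_dvd)
    also have "\<dots> dvd coeff (rogers_szego X n) r"
      using H by (simp add: weight_ideal_def)
    finally show "\<pi> ^ (d + 1) dvd coeff (rogers_szego X n) r" .
  qed
  finally show ?thesis unfolding \<pi>_def .
qed

text \<open>Factors at distinct roots are coprime: the product over A has order 0 at b, so the full
  power of the new factor divides the cofactor.\<close>

lemma prod_linear_power_dvd:
  fixes f :: "'a::idom poly"
  assumes "finite A" "\<And>a. a \<in> A \<Longrightarrow> [:- a, 1:] ^ e dvd f"
  shows "(\<Prod>a\<in>A. [:- a, 1:]) ^ e dvd f"
  using assms
proof (induction A rule: finite_induct)
  case (insert b A)
  let ?g = "(\<Prod>a\<in>A. [:- a, 1:]) ^ e"
  obtain h where h: "f = ?g * h" using insert by (auto elim: dvdE)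
  have "poly ?g b \<noteq> 0"
    using insert.hyps by (auto simp: poly_prod)
  then have "order b ?g = 0" by (rule order_0I)
  moreover have "[:- b, 1:] ^ e dvd ?g * h"
    using insert.prems h by simp
  ultimately have "[:- b, 1:] ^ e dvd h"
    unfolding order_divides using \<open>poly ?g b \<noteq> 0\<close> by (cases "h = 0") (auto simp: order_mult)
  then have "?g * [:- b, 1:] ^ e dvd f"
    unfolding h by (rule mult_dvd_mono[OF dvd_refl])
  then show ?case
    by (simp only: prod.insert[OF insert.hyps] power_mult_distrib mult.commute)
qed simp

lemma finite_primitive_unity_roots: "finite {\<omega>. primitive_unity_root N \<omega>}"
proof (cases "N = 0")
  case False
  then show ?thesis
    by (intro finite_subset[OF _ finite_roots_unity[of N]]) (auto simp: primitive_unity_root_def)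
qed (simp add: primitive_unity_root_def)

lemma lead_coeff_cyclotomic [simp]: "lead_coeff (cyclotomic N) = 1"
  by (simp add: cyclotomic_def lead_coeff_prod)

section \<open>Integrality\<close>

locale complex_subring =
  fixes R :: "complex set"
  assumes one_closed: "1 \<in> R"
    and diff_closed: "x \<in> R \<Longrightarrow> y \<in> R \<Longrightarrow> x - y \<in> R"
    and mult_closed: "x \<in> R \<Longrightarrow> y \<in> R \<Longrightarrow> x * y \<in> R"
begin

lemma zero_closed: "0 \<in> R"
  using diff_closed[OF one_closed one_closed] by simp

lemma add_closed: "x \<in> R \<Longrightarrow> y \<in> R \<Longrightarrow> x + y \<in> R"
  using diff_closed[of x "0 - y"] diff_closed[of 0 y] zero_closed by simp

lemma sum_closed: "(\<And>i. i \<in> A \<Longrightarrow> f i \<in> R) \<Longrightarrow> sum f A \<in> R"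
  by (induction A rule: infinite_finite_induct) (auto intro: zero_closed add_closed)

lemma power_closed: "x \<in> R \<Longrightarrow> x ^ n \<in> R"
  by (induction n) (auto intro: one_closed mult_closed)

lemma of_nat_closed: "of_nat n \<in> R"
  by (induction n) (auto intro: zero_closed one_closed add_closed)

lemma poly_closed: "P \<in> polys_over R \<Longrightarrow> x \<in> R \<Longrightarrow> poly P x \<in> R"
  by (auto simp: poly_altdef polys_over_def intro!: sum_closed mult_closed power_closed)

lemma polys_over_monom: "c \<in> R \<Longrightarrow> monom c n \<in> polys_over R"
  by (simp add: polys_over_def zero_closed)

lemma polys_over_zero: "0 \<in> polys_over R"
  by (simp add: polys_over_def zero_closed)

lemma polys_over_one: "1 \<in> polys_over R"
  using polys_over_monom[OF one_closed, of 0] by (simp flip: one_pCons add: monom_0)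

lemma polys_over_add: "p \<in> polys_over R \<Longrightarrow> q \<in> polys_over R \<Longrightarrow> p + q \<in> polys_over R"
  by (simp add: polys_over_def add_closed)

lemma polys_over_diff: "p \<in> polys_over R \<Longrightarrow> q \<in> polys_over R \<Longrightarrow> p - q \<in> polys_over R"
  by (simp add: polys_over_def diff_closed)

lemma polys_over_mult: "p \<in> polys_over R \<Longrightarrow> q \<in> polys_over R \<Longrightarrow> p * q \<in> polys_over R"
  by (auto simp: polys_over_def coeff_mult intro!: sum_closed mult_closed)

lemma polys_over_smult: "c \<in> R \<Longrightarrow> p \<in> polys_over R \<Longrightarrow> smult c p \<in> polys_over R"
  by (simp add: polys_over_def mult_closed)

lemma polys_over_sum: "(\<And>i. i \<in> A \<Longrightarrow> f i \<in> polys_over R) \<Longrightarrow> sum f A \<in> polys_over R"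
  by (induction A rule: infinite_finite_induct) (auto intro: polys_over_zero polys_over_add)

lemma polys_over_prod: "(\<And>i. i \<in> A \<Longrightarrow> f i \<in> polys_over R) \<Longrightarrow> prod f A \<in> polys_over R"
  by (induction A rule: infinite_finite_induct) (auto intro: polys_over_one polys_over_mult)

lemma polys_over_power: "p \<in> polys_over R \<Longrightarrow> p ^ n \<in> polys_over R"
  by (induction n) (auto intro: polys_over_one polys_over_mult)

text \<open>With e the degree of g, coefficient e + i of g h is \<open>coeff h i\<close> plus terms
  involving only higher coefficients of h. Hence downward induction on i, phrased through k.\<close>

lemma polys_over_monic_cofactor:
  assumes g: "g \<in> polys_over R" "lead_coeff g = 1" and gh: "g * h \<in> polys_over R"
  shows "h \<in> polys_over R"
proof -
  define e where "e = degree g"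
  have "coeff h i \<in> R" if "i + k > degree h" for i k
    using that
  proof (induction k arbitrary: i)
    case 0
    then show ?case by (simp add: coeff_eq_0 zero_closed)
  next
    case (Suc k)
    have "coeff (g * h) (e + i) = (\<Sum>j\<le>e + i. coeff g j * coeff h (e + i - j))"
      by (rule coeff_mult)
    also have "\<dots> = (\<Sum>j\<le>e. coeff g j * coeff h (e + i - j))"
      by (rule sum.mono_neutral_right) (auto simp: e_def coeff_eq_0)
    also have "\<dots> = (\<Sum>j<e. coeff g j * coeff h (e + i - j)) + coeff h i"
      using g(2) by (simp add: e_def flip: lessThan_Suc_atMost)
    finally have "coeff h i = coeff (g * h) (e + i) - (\<Sum>j<e. coeff g j * coeff h (e + i - j))"
      by simp
    also have "\<dots> \<in> R"
      using g(1) gh Suc by (auto simp: polys_over_def intro!: diff_closed sum_closed mult_closed)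
    finally show ?case .
  qed
  then show ?thesis
    unfolding polys_over_def using less_add_Suc2 by blast
qed

text \<open>The q-Pascal rule is free of division, so it keeps the coefficients in R.\<close>

lemma qbinom_polys_over: "qbinom n m \<in> polys_over R"
proof (induction n arbitrary: m)
  case 0
  then show ?case
    by (cases m) (auto simp: qbinom_eq_0 polys_over_zero polys_over_one)
next
  case (Suc n)
  show ?case
  proof (cases m)
    case (Suc m')
    then show ?thesis
      using Suc.IH
      by (cases "m' \<le> n")
        (auto simp: qbinom_Suc_Suc qbinom_eq_0 polys_over_zero
          intro!: polys_over_add polys_over_mult polys_over_monom one_closed)
  qed (simp add: polys_over_one)
qed

end

section \<open>Factorization of q^N - 1 into cyclotomic polynomials\<close>

lemma monom_minus_one_eq_prod_roots:
  assumes "N > 0"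
  shows "monom 1 N - 1 = (\<Prod>\<omega> | \<omega> ^ N = 1. [:- \<omega>, 1 :: complex:])"
proof -
  let ?p = "monom 1 N - 1 :: complex poly"
  obtain M where M: "N = Suc M" using assms gr0_implies_Suc by blast
  \<comment> \<open>The derivative N q^(N-1) vanishes at most at 0, which is not a root of q^N -
    1.\<close>
  have "rsquarefree ?p"
    unfolding rsquarefree_roots
    using of_nat_neq_0[of M, where 'a = complex]
    by (auto simp: poly_monom pderiv_diff pderiv_monom M)
  moreover have "degree ?p = N"
    using degree_add_eq_left[of "-1" "monom 1 N :: complex poly"] assms by (simp add: degree_monom_eq)
  then have "lead_coeff ?p = 1"
    using assms by simp
  moreover have "poly ?p \<omega> = 0 \<longleftrightarrow> \<omega> ^ N = 1" for \<omega>
    by (simp add: poly_monom)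
  ultimately show ?thesis
    using complex_poly_decompose_rsquarefree[of ?p] by simp
qed

lemma primitive_unity_root_unique:
  assumes "primitive_unity_root a \<omega>" "primitive_unity_root b \<omega>"
  shows "a = b"
  using assms unfolding primitive_unity_root_def by (metis linorder_neqE_nat)

lemma unity_root_imp_primitive:
  assumes "\<omega> ^ N = 1" "N > 0"
  obtains a where "a dvd N" "primitive_unity_root a \<omega>"
proof -
  define a where "a = (LEAST a. a > 0 \<and> \<omega> ^ a = 1)"
  have a: "a > 0 \<and> \<omega> ^ a = 1"
    unfolding a_def by (rule LeastI[of _ N]) (use assms in auto)
  have min: "\<omega> ^ j \<noteq> 1" if "0 < j" "j < a" for j
    using not_less_Least[of j "\<lambda>a. a > 0 \<and> \<omega> ^ a = 1"] that unfolding a_def by auto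
  have "\<omega> ^ N = (\<omega> ^ a) ^ (N div a) * \<omega> ^ (N mod a)"
    by (simp flip: power_mult power_add)
  then have "\<omega> ^ (N mod a) = 1" using a assms by simp
  then have "N mod a = 0" using min[of "N mod a"] a by auto
  then show ?thesis using that[of a] a min by (auto simp: primitive_unity_root_def)
qed

text \<open>The N-th roots of unity are partitioned by their exact order, a divisor of N.\<close>

lemma monom_minus_one_eq_prod_cyclotomic:
  assumes "N > 0"
  shows "monom 1 N - 1 = (\<Prod>a | a dvd N. cyclotomic a)"
proof -
  have "{\<omega>. \<omega> ^ N = 1} = (\<Union>a\<in>{a. a dvd N}. {\<omega>. primitive_unity_root a \<omega>})"
    using assms unity_root_imp_primitive
    by (auto simp: primitive_unity_root_def power_mult elim!: dvdE) blast
  moreover have "(\<Prod>\<omega>\<in>(\<Union>a\<in>{a. a dvd N}. {\<omega>. primitive_unity_root a \<omega>}). [:- \<omega>, 1:])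
      = (\<Prod>a | a dvd N. cyclotomic a)"
    unfolding cyclotomic_def using assms finite_primitive_unity_roots
    by (intro prod.UNION_disjoint) (auto dest: primitive_unity_root_unique)
  ultimately show ?thesis
    using monom_minus_one_eq_prod_roots[OF assms] by simp
qed

text \<open>By strong induction, \<open>cyclotomic N\<close> is the cofactor in q^N - 1 of a monic
  product over the proper divisors.\<close>

lemma (in complex_subring) cyclotomic_polys_over: "cyclotomic N \<in> polys_over R"
proof (induction N rule: less_induct)
  case (less N)
  show ?case
  proof (cases "N = 0")
    case True
    then show ?thesis by (simp add: cyclotomic_def primitive_unity_root_def polys_over_one)
  next
    case False
    define g where "g = (\<Prod>a\<in>{a. a dvd N} - {N}. cyclotomic a)"
    have "g * cyclotomic N = monom 1 N - 1"
      using False prod.remove[of "{a. a dvd N}" N cyclotomic]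
      by (simp add: g_def monom_minus_one_eq_prod_cyclotomic mult.commute)
    then have "g * cyclotomic N \<in> polys_over R"
      by (simp add: polys_over_diff polys_over_monom polys_over_one one_closed)
    moreover have "g \<in> polys_over R"
      unfolding g_def using False
      by (intro polys_over_prod less) (auto dest: dvd_imp_le)
    moreover have "lead_coeff g = 1"
      by (simp add: g_def lead_coeff_prod)
    ultimately show ?thesis
      by (rule polys_over_monic_cofactor[rotated 2])
  qed
qed

section \<open>The ring generated by \<zeta> and the congruence over it\<close>

lemma map_poly_of_int_mult:
  "map_poly of_int (p * q) = (map_poly of_int p * map_poly of_int q :: 'a::comm_ring_1 poly)"
  by (rule poly_eqI) (simp add: coeff_map_poly coeff_mult)

lemma complex_subring_int_adjoin: "complex_subring (int_adjoin \<zeta>)"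
proof
  show "1 \<in> int_adjoin \<zeta>"
    unfolding int_adjoin_def by (rule range_eqI[of _ _ 1]) simp
next
  fix x y assume "x \<in> int_adjoin \<zeta>" "y \<in> int_adjoin \<zeta>"
  then obtain p q where x: "x = poly (map_poly of_int p) \<zeta>" and y: "y = poly (map_poly of_int q) \<zeta>"
    unfolding int_adjoin_def by blast
  have "map_poly of_int (p - q) = (map_poly of_int p - map_poly of_int q :: complex poly)"
    by (rule poly_eqI) (simp add: coeff_map_poly)
  then show "x - y \<in> int_adjoin \<zeta>"
    unfolding int_adjoin_def by (intro range_eqI[of _ _ "p - q"]) (simp add: x y)
  show "x * y \<in> int_adjoin \<zeta>"
    unfolding int_adjoin_def
    by (intro range_eqI[of _ _ "p * q"]) (simp add: x y map_poly_of_int_mult)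
qed

lemma generator_in_int_adjoin: "\<zeta> \<in> int_adjoin \<zeta>"
  unfolding int_adjoin_def by (rule range_eqI[of _ _ "[:0, 1:]"]) (simp add: map_poly_pCons)

theorem theorem3p5:
  fixes c k d z n :: nat and \<zeta> :: complex and P :: "complex poly"
  assumes "c > 0" and "k > 0" and "odd k"
    and "primitive_unity_root (2 * c) \<zeta>"
    and "P \<in> polys_over (int_adjoin \<zeta>)"
    and "n \<ge> (degree P + 2 * d + 1) * k * c"
  shows "poly_cong_over (int_adjoin \<zeta>)
           (\<Sum>m\<le>n. smult (\<zeta> ^ m * poly P (of_nat m)) (monom 1 (z * m) * qbinom n m))
           0 (cyclotomic (k * c) ^ (d + 1))"
proof -
  let ?F = "\<Sum>m\<le>n. smult (\<zeta> ^ m * poly P (of_nat m)) (monom 1 (z * m) * qbinom n m)"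
  interpret complex_subring "int_adjoin \<zeta>" by (rule complex_subring_int_adjoin)
  have F: "?F \<in> polys_over (int_adjoin \<zeta>)"
    by (intro polys_over_sum polys_over_smult polys_over_mult polys_over_monom qbinom_polys_over
        mult_closed power_closed poly_closed of_nat_closed one_closed generator_in_int_adjoin assms)
  have \<Phi>: "cyclotomic (k * c) ^ (d + 1) \<in> polys_over (int_adjoin \<zeta>)"
    by (intro polys_over_power cyclotomic_polys_over)
  \<comment> \<open>Primitivity applies because 0 < c < 2c.\<close>
  have "(\<zeta> ^ c)\<^sup>2 = 1" "\<zeta> ^ c \<noteq> 1"
    using assms(1,4) by (auto simp: primitive_unity_root_def mult.commute simp flip: power_mult)
  then have "\<zeta> ^ c = - 1"
    by (simp add: power2_eq_1_iff)
  then have \<zeta>: "\<zeta> ^ (k * c) = - 1"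
    using \<open>odd k\<close> by (simp add: mult.commute[of k] power_mult)
  have "cyclotomic (k * c) ^ (d + 1) dvd ?F"
    unfolding cyclotomic_def using assms(6)[unfolded mult.assoc]
    by (intro prod_linear_power_dvd finite_primitive_unity_roots linear_power_dvd_qbinom_sum
        [where N = "k * c"] \<zeta>) auto
  then obtain h where h: "?F = cyclotomic (k * c) ^ (d + 1) * h" by (rule dvdE)
  \<comment> \<open>The division took place over the complex numbers; since the modulus is monic,
    its cofactor descends to the subring.\<close>
  have "h \<in> polys_over (int_adjoin \<zeta>)"
    by (rule polys_over_monic_cofactor[OF \<Phi> _ F[unfolded h]])
      (simp add: lead_coeff_power del: power_Suc)
  then show ?thesis
    unfolding poly_cong_over_def using F \<Phi> h polys_over_zero by auto
qed

end
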